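(* Let $K\subset\mathbb{R}^2$ be a polygon with $N$ edges, and let $\{\pi_n\}_{n\in\mathbb{N}_0}$ be a sequence of orthogonal polynomials on $[a,b]$ with respect to a weight function $\omega$. For a fixed $m\in\mathbb{N}$, the following statements are equivalent: (1) The polynomial $\pi_m$ satisfies $\left(\dfrac{\pi_m(b)}{\pi_m(a)}\right)^N\neq 1$; (2) The triple $\mathcal{A}_{m,N}=(\partial K,\mathcal{S}_m^0(\partial K),\Sigma_{\partial K})$ (built with the interval $[a,b]$ and the weight $\omega$) defines a finite element.
   Context: $\mathbb{N}=\{1,2,\dots\}$, $\mathbb{N}_0=\mathbb{N}\cup\{0\}$, $a<b$ are real numbers. A weight function $\omega$ on $[a,b]$ is a nonnegative integrable function with $\int_a^b\omega(x)\,dx>0$ and all moments $\int_a^b x^n\omega(x)\,dx$ finite. A sequence of real polynomials $\{\pi_n\}_{n\in\mathbb{N}_0}$ is orthogonal on $[a,b]$ with respect to $\omega$ if $\deg\pi_n=n$ and $\int_a^b\pi_m\pi_n\omega\,dx=K_n\delta_{mn}$ with $K_n\ne0$ for all $m,n$. $K$ has vertices $\mathbf v_1,\dots,\mathbf v_N$ ordered counter-clockwise, edges $e_i=[\mathbf v_i,\mathbf v_{i+1}]$, $i=1,\dots,N$, with $\mathbf v_{N+1}=\mathbf v_1$. Each edge is parametrized by $\psi_i(x)=\frac{b-x}{b-a}\mathbf v_i+\frac{x-a}{b-a}\mathbf v_{i+1}$, $x\in[a,b]$, and for a function $u$ on $\partial K$ with continuous restriction to each edge, $\widetilde\gamma_i(u)(x)=u|_{e_i}(\psi_i(x))$.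 $\mathcal{S}_m(\partial K)$ is the space of $f\in L^2(\partial K)$ such that $f|_{e_i}$ is a polynomial of degree at most $m$ on $e_i$ for each $i$ (no continuity at vertices required), and $\mathcal{S}_m^0(\partial K)=\mathcal{S}_m(\partial K)\cap C^0(\partial K)$; $\dim\mathcal{S}_m^0(\partial K)=mN$. Given a basis $\{b_j: j=1,\dots,mN\}$ of $\mathcal{S}_{m-1}(\partial K)$, $\Sigma_{\partial K}=\{\mathcal L_j: j=1,\dots,mN\}$ with $\mathcal L_j(f)=\sum_{i=1}^N\int_a^b\widetilde\gamma_i(f)(x)\,\widetilde\gamma_i(b_j)(x)\,\omega(x)\,dx$ for $f\in\mathcal{S}_m^0(\partial K)$. The triple $\mathcal{A}_{m,N}$ "defines a finite element" means unisolvence: the only $p\in\mathcal{S}_m^0(\partial K)$ with $\mathcal L_j(p)=0$ for all $j=1,\dots,mN$ is $p=0$. *)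

theory Defs
  imports "HOL-Analysis.Analysis" "HOL-Computational_Algebra.Polynomial"
begin

definition weight_function :: "real \<Rightarrow> real \<Rightarrow> (real \<Rightarrow> real) \<Rightarrow> bool" where
  "weight_function a b \<omega> \<longleftrightarrow>
     (\<forall>x\<in>{a..b}. 0 \<le> \<omega> x) \<and>
     set_integrable lebesgue {a..b} \<omega> \<and>
     0 < (LINT x:{a..b}|lebesgue. \<omega> x) \<and>
     (\<forall>n::nat. set_integrable lebesgue {a..b} (\<lambda>x. x ^ n * \<omega> x))"

definition orthogonal_polynomials ::
    "real \<Rightarrow> real \<Rightarrow> (real \<Rightarrow> real) \<Rightarrow> (nat \<Rightarrow> real poly) \<Rightarrow> bool" where
  "orthogonal_polynomials a b \<omega> P \<longleftrightarrow>
     (\<forall>n. degree (P n) = n) \<and>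
     (\<exists>\<kappa>::nat \<Rightarrow> real.
        (\<forall>n. \<kappa> n \<noteq> 0) \<and>
        (\<forall>m n. (LINT x:{a..b}|lebesgue. poly (P m) x * poly (P n) x * \<omega> x)
                 = (if m = n then \<kappa> n else 0)))"

text \<open>The vertices of an \<open>N\<close>-gon are \<open>v 1, \<dots>, v N\<close>, and \<open>v (N + 1) = v 1\<close>.\<close>

definition edge :: "(nat \<Rightarrow> real^2) \<Rightarrow> nat \<Rightarrow> (real^2) set" where
  "edge v i = closed_segment (v i) (v (i + 1))"

text \<open>Distinct edges meet only in a common endpoint: for \<open>N \<ge> 3\<close> and pairwise distinct vertices,
  the right-hand side of the last equation is one vertex for (cyclically) consecutive edges and
  empty otherwise.\<close>

definition simple_closed_polygonal_chain :: "nat \<Rightarrow> (nat \<Rightarrow> real^2) \<Rightarrow> bool" where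
  "simple_closed_polygonal_chain N v \<longleftrightarrow>
     3 \<le> N \<and> v (N + 1) = v 1 \<and> inj_on v {1..N} \<and>
     (\<forall>i\<in>{1..N}. \<forall>j\<in>{1..N}. i \<noteq> j \<longrightarrow>
        edge v i \<inter> edge v j = {v i, v (i + 1)} \<inter> {v j, v (j + 1)})"

text \<open>Rotation of the plane by a right angle, counter-clockwise.\<close>

definition rot90 :: "real^2 \<Rightarrow> real^2" where
  "rot90 w = vector [- (w $ 2), w $ 1]"

text \<open>A polygon is a compact region bounded by a simple closed polygonal chain. (By the Jordan
  curve theorem such a set is the chain together with its inside; requiring nonempty interior
  excludes the chain itself.) The vertices are in counter-clockwise order if the interior lies
  immediately to the left of every directed edge.\<close>

definition polygon_ccw :: "(real^2) set \<Rightarrow> nat \<Rightarrow> (nat \<Rightarrow> real^2) \<Rightarrow> bool" where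
  "polygon_ccw K N v \<longleftrightarrow>
     simple_closed_polygonal_chain N v \<and>
     compact K \<and> interior K \<noteq> {} \<and> frontier K = (\<Union>i\<in>{1..N}. edge v i) \<and>
     (\<forall>i\<in>{1..N}. \<forall>x\<in>open_segment (v i) (v (i + 1)).
        \<forall>\<^sub>F t in at_right 0. x + t *\<^sub>R rot90 (v (i + 1) - v i) \<in> interior K)"

text \<open>Elements of \<open>L\<^sup>2(\<partial>K)\<close> are represented by functions on the plane of which only the values on
  \<open>\<partial>K\<close> matter, up to equality almost everywhere with respect to arc length. Since
  \<open>linepath (v i) (v (i + 1))\<close> has constant speed, measurability, square integrability and
  almost-everywhere equality on an edge can be expressed in its parameter.\<close>

definition L2_bdry :: "nat \<Rightarrow> (nat \<Rightarrow> real^2) \<Rightarrow> (real^2 \<Rightarrow> real) set" where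
  "L2_bdry N v =
     {f. \<forall>i\<in>{1..N}.
        (\<lambda>t. f (linepath (v i) (v (i + 1)) t)) \<in> borel_measurable (lebesgue_on {0..1}) \<and>
        integrable (lebesgue_on {0..1}) (\<lambda>t. (f (linepath (v i) (v (i + 1)) t))\<^sup>2)}"

definition ae_eq_bdry ::
    "nat \<Rightarrow> (nat \<Rightarrow> real^2) \<Rightarrow> (real^2 \<Rightarrow> real) \<Rightarrow> (real^2 \<Rightarrow> real) \<Rightarrow> bool" where
  "ae_eq_bdry N v f g \<longleftrightarrow>
     (\<forall>i\<in>{1..N}. AE t in lebesgue_on {0..1}.
        f (linepath (v i) (v (i + 1)) t) = g (linepath (v i) (v (i + 1)) t))"

text \<open>\<open>S\<^sub>m(\<partial>K)\<close>: being a polynomial of degree at most \<open>m\<close> on an edge does not depend on the affine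
  parametrization. The condition is imposed almost everywhere, so that the one value of the
  representative at a vertex does not force continuity there.\<close>

definition S_space :: "nat \<Rightarrow> (nat \<Rightarrow> real^2) \<Rightarrow> nat \<Rightarrow> (real^2 \<Rightarrow> real) set" where
  "S_space N v m =
     {f \<in> L2_bdry N v. \<forall>i\<in>{1..N}. \<exists>p::real poly. degree p \<le> m \<and>
        (AE t in lebesgue_on {0..1}. f (linepath (v i) (v (i + 1)) t) = poly p t)}"

definition S0_space ::
    "(real^2) set \<Rightarrow> nat \<Rightarrow> (nat \<Rightarrow> real^2) \<Rightarrow> nat \<Rightarrow> (real^2 \<Rightarrow> real) set" where
  "S0_space K N v m = {f \<in> S_space N v m. continuous_on (frontier K) f}"

text \<open>\<open>B 1, \<dots>, B d\<close> is a basis of \<open>S\<^sub>m(\<partial>K)\<close>, as a space of almost-everywhere classes.\<close>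

definition basis_of_S ::
    "nat \<Rightarrow> (nat \<Rightarrow> real^2) \<Rightarrow> nat \<Rightarrow> nat \<Rightarrow> (nat \<Rightarrow> real^2 \<Rightarrow> real) \<Rightarrow> bool" where
  "basis_of_S N v m d B \<longleftrightarrow>
     (\<forall>j\<in>{1..d}. B j \<in> S_space N v m) \<and>
     (\<forall>c::nat \<Rightarrow> real. ae_eq_bdry N v (\<lambda>y. \<Sum>j=1..d. c j * B j y) (\<lambda>y. 0)
        \<longrightarrow> (\<forall>j\<in>{1..d}. c j = 0)) \<and>
     (\<forall>f\<in>S_space N v m. \<exists>c::nat \<Rightarrow> real. ae_eq_bdry N v f (\<lambda>y. \<Sum>j=1..d. c j * B j y))"

definition edge_param :: "real \<Rightarrow> real \<Rightarrow> (nat \<Rightarrow> real^2) \<Rightarrow> nat \<Rightarrow> real \<Rightarrow> real^2" where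
  "edge_param a b v i x = ((b - x) / (b - a)) *\<^sub>R v i + ((x - a) / (b - a)) *\<^sub>R v (i + 1)"

text \<open>For a representative of an \<open>L\<^sup>2\<close> class this is determined up to null sets, which is all
  that the integrals below depend on.\<close>

definition edge_trace ::
    "real \<Rightarrow> real \<Rightarrow> (nat \<Rightarrow> real^2) \<Rightarrow> nat \<Rightarrow> (real^2 \<Rightarrow> real) \<Rightarrow> real \<Rightarrow> real" where
  "edge_trace a b v i u x = u (edge_param a b v i x)"

definition dof ::
    "real \<Rightarrow> real \<Rightarrow> (real \<Rightarrow> real) \<Rightarrow> nat \<Rightarrow> (nat \<Rightarrow> real^2) \<Rightarrow> (nat \<Rightarrow> real^2 \<Rightarrow> real)
      \<Rightarrow> nat \<Rightarrow> (real^2 \<Rightarrow> real) \<Rightarrow> real" where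
  "dof a b \<omega> N v B j f =
     (\<Sum>i=1..N. LINT x:{a..b}|lebesgue. edge_trace a b v i f x * edge_trace a b v i (B j) x * \<omega> x)"

definition bdry_triple ::
    "real \<Rightarrow> real \<Rightarrow> (real \<Rightarrow> real) \<Rightarrow> (real^2) set \<Rightarrow> nat \<Rightarrow> (nat \<Rightarrow> real^2) \<Rightarrow> nat
      \<Rightarrow> (nat \<Rightarrow> real^2 \<Rightarrow> real)
      \<Rightarrow> (real^2) set \<times> (real^2 \<Rightarrow> real) set \<times> ((real^2 \<Rightarrow> real) \<Rightarrow> real) set" where
  "bdry_triple a b \<omega> K N v m B =
     (frontier K, S0_space K N v m, (\<lambda>j. dof a b \<omega> N v B j) ` {1..m * N})"

text \<open>Unisolvence; \<open>p = 0\<close> means that \<open>p\<close> vanishes on the underlying domain.\<close>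

definition defines_finite_element ::
    "'x set \<times> ('x \<Rightarrow> real) set \<times> (('x \<Rightarrow> real) \<Rightarrow> real) set \<Rightarrow> bool" where
  "defines_finite_element \<A> \<longleftrightarrow>
     (case \<A> of (D, V, \<Sigma>) \<Rightarrow> \<forall>p\<in>V. (\<forall>L\<in>\<Sigma>. L p = 0) \<longrightarrow> (\<forall>x\<in>D. p x = 0))"

end

theory Submission
  imports Defs
begin

text \<open>
  Write \<open>r = \<pi>\<^sub>m(b) / \<pi>\<^sub>m(a)\<close>. Both values are nonzero: if \<open>\<pi>\<^sub>m = (x - c) q\<close> for an endpoint \<open>c\<close>, then
  \<open>\<pi>\<^sub>m q = (x - c) q\<^sup>2\<close> has constant sign on \<open>[a, b]\<close>, while its integral against the weight vanishes
  because \<open>deg q < m\<close> (\<open>P_endpoint_nonzero\<close>).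

  Let \<open>f\<close> be a continuous, edgewise polynomial function of degree at most \<open>m\<close>. As functions in
  \<open>S\<^sub>m\<^sub>-\<^sub>1\<close> may jump at the vertices, they include those that are an arbitrary polynomial of degree
  less than \<open>m\<close> on one edge and zero elsewhere. So all degrees of freedom of \<open>f\<close> vanish if and only
  if, on each edge, the polynomial of \<open>f\<close> is orthogonal to all polynomials of degree less than \<open>m\<close>,
  that is, a multiple \<open>c\<^sub>i \<pi>\<^sub>m\<close> of \<open>\<pi>\<^sub>m\<close> (\<open>dofs_vanish_imp_multiple_of_P\<close> and \<open>wint_P_less\<close>).

  Continuity at the vertices means \<open>c\<^sub>i \<pi>\<^sub>m(b) = c\<^sub>i\<^sub>+\<^sub>1 \<pi>\<^sub>m(a)\<close>, that is, \<open>c\<^sub>i\<^sub>+\<^sub>1 = r c\<^sub>i\<close>, cyclically in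
  \<open>i\<close>. Such coefficients exist with \<open>c\<^sub>1 \<noteq> 0\<close> if and only if \<open>r\<^sup>N = 1\<close>
  (\<open>unisolvent_if_ratio\<close> and \<open>not_unisolvent_if_ratio\<close>).

  Both the test functions on a single edge and the nonzero function in the case \<open>r\<^sup>N = 1\<close> are obtained
  from a family of polynomials by \<open>glue\<close>.
\<close>

section \<open>Integration of polynomials against a weight\<close>

text \<open>No measurability is needed here, because Lebesgue measure is complete and the Bochner integral
  of a function that is not integrable is \<open>0\<close>.\<close>

lemma set_lebesgue_integral_spike:
  fixes f g :: "real \<Rightarrow> real"
  assumes "AE x in lebesgue. x \<in> A \<longrightarrow> f x = g x"
  shows "(LINT x:A|lebesgue. f x) = (LINT x:A|lebesgue. g x)"
proof -
  let ?f = "\<lambda>x. indicator A x *\<^sub>R f x" and ?g = "\<lambda>x. indicator A x *\<^sub>R g x"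
  have fg: "AE x in lebesgue. ?f x = ?g x"
    using assms by eventually_elim (auto simp: indicator_def)
  then have gf: "AE x in lebesgue. ?g x = ?f x"
    by eventually_elim (rule sym)
  show ?thesis
  proof (cases "?f \<in> borel_measurable lebesgue")
    case True
    then have "?g \<in> borel_measurable lebesgue"
      using fg by (rule borel_measurable_AE)
    with True fg show ?thesis
      unfolding set_lebesgue_integral_def by (intro integral_cong_AE)
  next
    case False
    then have "?g \<notin> borel_measurable lebesgue"
      using borel_measurable_AE[OF _ gf] by blast
    with False have "\<not> integrable lebesgue ?f" "\<not> integrable lebesgue ?g"
      using borel_measurable_integrable by blast+
    then show ?thesis
      unfolding set_lebesgue_integral_def by (simp add: not_integrable_integral_eq)
  qed
qed

locale weighted_interval =
  fixes a b :: real and \<omega> :: "real \<Rightarrow> real"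
  assumes weight: "weight_function a b \<omega>"
begin

text \<open>The functional \<open>p \<mapsto> \<integral>\<^sub>a\<^sup>b p \<omega>\<close>; the inner product of \<open>p\<close> and \<open>q\<close> is its value at \<open>p * q\<close>.\<close>

definition wint :: "real poly \<Rightarrow> real" where
  "wint p = (LINT x:{a..b}|lebesgue. poly p x * \<omega> x)"

lemma integrable_poly_weight: "set_integrable lebesgue {a..b} (\<lambda>x. poly p x * \<omega> x)"
proof -
  have "set_integrable lebesgue {a..b} (\<lambda>x. coeff p i * (x ^ i * \<omega> x))" for i
    using weight by (intro set_integrable_mult_right) (simp add: weight_function_def)
  then have "integrable lebesgue
      (\<lambda>x. \<Sum>i\<le>degree p. indicator {a..b} x *\<^sub>R (coeff p i * (x ^ i * \<omega> x)))"
    unfolding set_integrable_def by (intro Bochner_Integration.integrable_sum)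
  moreover have "(\<lambda>x. \<Sum>i\<le>degree p. indicator {a..b} x *\<^sub>R (coeff p i * (x ^ i * \<omega> x)))
      = (\<lambda>x. indicator {a..b} x *\<^sub>R (poly p x * \<omega> x))"
    by (simp add: poly_altdef sum_distrib_left sum_distrib_right mult_ac)
  ultimately show ?thesis
    by (simp add: set_integrable_def)
qed

lemma wint_add: "wint (p + q) = wint p + wint q"
  unfolding wint_def poly_add distrib_right by (intro set_integral_add integrable_poly_weight)

lemma wint_smult: "wint (smult c p) = c * wint p"
  by (simp add: wint_def mult.assoc)

lemma wint_diff: "wint (p - q) = wint p - wint q"
  using wint_add[of p "smult (-1) q"] wint_smult[of "-1" q] by simp

lemma wint_0 [simp]: "wint 0 = 0"
  by (simp add: wint_def set_lebesgue_integral_def)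

lemma wint_sum: "wint (\<Sum>i\<in>A. f i) = (\<Sum>i\<in>A. wint (f i))"
  by (induction A rule: infinite_finite_induct) (simp_all add: wint_add)

text \<open>Otherwise the weight would vanish almost everywhere outside the finitely many roots of \<open>p\<close>.\<close>

lemma wint_nonneg_eq_0:
  assumes nonneg: "\<And>x. x \<in> {a..b} \<Longrightarrow> 0 \<le> poly p x" and zero: "wint p = 0"
  shows "p = 0"
proof (rule ccontr)
  assume "p \<noteq> 0"
  let ?f = "\<lambda>x. indicator {a..b} x *\<^sub>R (poly p x * \<omega> x)"
  have "AE x in lebesgue. 0 \<le> ?f x"
    using nonneg weight by (auto simp: weight_function_def indicator_def)
  moreover have "integrable lebesgue ?f" "integral\<^sup>L lebesgue ?f = 0"
    using integrable_poly_weight[of p] zero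
    by (simp_all add: set_integrable_def wint_def set_lebesgue_integral_def)
  ultimately have ae: "AE x in lebesgue. ?f x = 0"
    by (subst (asm) integral_nonneg_eq_0_iff_AE)
  have "negligible {x. poly p x = 0}"
    using \<open>p \<noteq> 0\<close> by (intro negligible_finite poly_roots_finite)
  then have "AE x in lebesgue. poly p x \<noteq> 0"
    by (auto simp: eventually_ae_filter_negligible)
  with ae have "AE x in lebesgue. x \<in> {a..b} \<longrightarrow> \<omega> x = 0"
    by eventually_elim (auto simp: indicator_def)
  then have "(LINT x:{a..b}|lebesgue. \<omega> x) = (LINT x:{a..b}|lebesgue. 0)"
    by (rule set_lebesgue_integral_spike)
  then show False
    using weight by (simp add: weight_function_def set_lebesgue_integral_def)
qed

lemma wint_square_eq_0: "wint (p * p) = 0 \<Longrightarrow> p = 0"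
  using wint_nonneg_eq_0[of "p * p"] by simp

end

section \<open>Orthogonal polynomials\<close>

lemma degree_diff_smult_less:
  fixes p q :: "real poly"
  assumes "degree p \<le> n" "degree q = n" "0 < n"
  shows "degree (p - smult (coeff p n / coeff q n) q) < n"
proof -
  let ?r = "p - smult (coeff p n / coeff q n) q"
  have "coeff q n \<noteq> 0"
    using assms by (metis degree_0 leading_coeff_0_iff less_irrefl)
  then have "coeff ?r n = 0"
    by simp
  moreover have "degree ?r \<le> n"
    using assms by (intro degree_diff_le order_trans[OF degree_smult_le]) auto
  ultimately show ?thesis
    using \<open>0 < n\<close> by (metis degree_0 leading_coeff_0_iff le_neq_implies_less)
qed

locale weighted_orthogonal = weighted_interval +
  fixes P :: "nat \<Rightarrow> real poly"
  assumes orthogonal: "orthogonal_polynomials a b \<omega> P"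
begin

lemma degree_P: "degree (P n) = n"
  using orthogonal by (simp add: orthogonal_polynomials_def)

lemma wint_P_P: "wint (P m * P n) = 0" if "m \<noteq> n"
  using orthogonal that by (auto simp: orthogonal_polynomials_def wint_def)

lemma P_nonzero: "P n \<noteq> 0"
proof
  assume "P n = 0"
  then have "(LINT x:{a..b}|lebesgue. poly (P n) x * poly (P n) x * \<omega> x) = 0"
    by (simp add: set_lebesgue_integral_def)
  with orthogonal show False
    by (auto simp: orthogonal_polynomials_def)
qed

lemma wint_P_less:
  assumes "degree q < m"
  shows "wint (P m * q) = 0"
  using assms
proof (induction "degree q" arbitrary: q rule: less_induct)
  case less
  show ?case
  proof (cases "degree q = 0")
    case True
    obtain c d where c: "q = [:c:]" and d: "P 0 = [:d:]"
      using True degree_P[of 0] by (metis degree_eq_zeroE)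
    have "d \<noteq> 0"
      using P_nonzero[of 0] d by auto
    with c d have "q = smult (c / d) (P 0)"
      by simp
    then show ?thesis
      using wint_P_P[of m 0] less.prems by (simp add: wint_smult)
  next
    case False
    let ?n = "degree q"
    let ?c = "coeff q ?n / coeff (P ?n) ?n"
    let ?r = "q - smult ?c (P ?n)"
    have "degree ?r < ?n"
      using False by (intro degree_diff_smult_less degree_P) auto
    then have "wint (P m * ?r) = 0"
      using less by simp
    moreover have "wint (P m * P ?n) = 0"
      using less.prems by (intro wint_P_P) simp
    ultimately show ?thesis
      by (simp add: algebra_simps wint_diff wint_smult)
  qed
qed

lemma orthogonal_imp_multiple_of_P:
  assumes "degree p \<le> m" "1 \<le> m" and orth: "\<And>q. degree q < m \<Longrightarrow> wint (p * q) = 0"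
  shows "\<exists>c. p = smult c (P m)"
proof -
  let ?c = "coeff p m / coeff (P m) m"
  let ?r = "p - smult ?c (P m)"
  have deg: "degree ?r < m"
    using assms by (intro degree_diff_smult_less degree_P) auto
  have "wint (?r * ?r) = wint (p * ?r) - ?c * wint (P m * ?r)"
    unfolding left_diff_distrib[of p _ ?r] by (simp add: wint_diff wint_smult)
  also have "\<dots> = 0"
    using orth[OF deg] wint_P_less[OF deg] by simp
  finally show ?thesis
    using wint_square_eq_0[of ?r] by auto
qed

text \<open>If \<open>c\<close> is an endpoint with \<open>P m = (x - c) * q\<close>, then \<open>(x - c) * q\<^sup>2\<close> has constant sign on
  the interval, yet its weighted integral vanishes because \<open>deg q < m\<close>.\<close>

lemma P_endpoint_nonzero:
  assumes "1 \<le> m" "c = a \<or> c = b"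
  shows "poly (P m) c \<noteq> 0"
proof
  assume "poly (P m) c = 0"
  then obtain q where q: "P m = [:- c, 1:] * q"
    by (auto simp: poly_eq_0_iff_dvd elim: dvdE)
  have "q \<noteq> 0"
    using q P_nonzero[of m] by auto
  then have "degree (P m) = Suc (degree q)"
    unfolding q by (subst degree_mult_eq) auto
  then have "wint (P m * q) = 0"
    by (intro wint_P_less) (simp add: degree_P)
  moreover have "(\<forall>x\<in>{a..b}. 0 \<le> poly (P m * q) x) \<or> (\<forall>x\<in>{a..b}. 0 \<le> poly (smult (-1) (P m * q)) x)"
  proof -
    have eq: "poly (P m * q) x = (x - c) * (poly q x)\<^sup>2" for x
      by (simp add: q power2_eq_square algebra_simps)
    show ?thesis
      using assms(2)
    proof
      assume "c = a"
      then have "\<forall>x\<in>{a..b}. 0 \<le> poly (P m * q) x"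
        unfolding eq by auto
      then show ?thesis ..
    next
      assume "c = b"
      then have "\<forall>x\<in>{a..b}. 0 \<le> poly (smult (-1) (P m * q)) x"
        unfolding poly_smult eq by (auto simp: mult_nonpos_nonneg)
      then show ?thesis ..
    qed
  qed
  ultimately have "P m * q = 0"
    using wint_nonneg_eq_0[of "P m * q"] wint_nonneg_eq_0[of "smult (-1) (P m * q)"]
      wint_smult[of "-1" "P m * q"] by (metis mult_zero_right smult_eq_0_iff zero_neq_neg_one)
  with P_nonzero \<open>q \<noteq> 0\<close> show False
    by simp
qed

end

section \<open>Polynomials and null sets on an interval\<close>

lemma AE_affine_unit_interval:
  fixes a b :: real
  assumes "a < b" and "AE t in lebesgue_on {0..1}. Q t"
  shows "AE x in lebesgue. x \<in> {a..b} \<longrightarrow> Q ((x - a) / (b - a))"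
proof -
  have "AE t in lebesgue. t \<in> {0..1} \<longrightarrow> Q t"
    using assms(2) by (subst (asm) AE_restrict_space_iff) auto
  then obtain Z where Z: "negligible Z" "{t. \<not> (t \<in> {0..1} \<longrightarrow> Q t)} \<subseteq> Z"
    by (auto simp: eventually_ae_filter_negligible)
  have "negligible ((\<lambda>t. a + (b - a) * t) ` Z)"
    using Z(1) by (intro negligible_differentiable_image_negligible)
      (auto intro!: derivative_intros differentiable_at_imp_differentiable_on)
  moreover have "{x. \<not> (x \<in> {a..b} \<longrightarrow> Q ((x - a) / (b - a)))} \<subseteq> (\<lambda>t. a + (b - a) * t) ` Z"
  proof
    fix x
    assume "x \<in> {x. \<not> (x \<in> {a..b} \<longrightarrow> Q ((x - a) / (b - a)))}"
    then have "(x - a) / (b - a) \<in> Z"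
      using Z(2) \<open>a < b\<close> by (auto simp: divide_simps)
    moreover have "x = a + (b - a) * ((x - a) / (b - a))"
      using \<open>a < b\<close> by simp
    ultimately show "x \<in> (\<lambda>t. a + (b - a) * t) ` Z"
      by (metis imageI)
  qed
  ultimately show ?thesis
    unfolding eventually_ae_filter_negligible by blast
qed

text \<open>The set of points of the open interval where the functions differ is open and null, hence
  empty.\<close>

lemma continuous_AE_eq_imp_eq:
  fixes f g :: "real \<Rightarrow> real"
  assumes "a < b" "continuous_on {a..b} f" "continuous_on {a..b} g"
    and ae: "AE x in lebesgue. x \<in> {a..b} \<longrightarrow> f x = g x" and "x \<in> {a..b}"
  shows "f x = g x"
proof -
  let ?h = "\<lambda>x. f x - g x"
  let ?U = "{x \<in> {a<..<b}. ?h x \<in> - {0}}"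
  have cont: "continuous_on {a..b} ?h"
    using assms by (intro continuous_intros)
  have "open ({a<..<b} \<inter> ?h -` (- {0}))"
    by (intro continuous_open_preimage continuous_on_subset[OF cont]) auto
  then have "open ?U"
    by (simp add: vimage_def Int_def)
  moreover have "negligible ?U"
  proof -
    obtain Z where "negligible Z" "{x. \<not> (x \<in> {a..b} \<longrightarrow> f x = g x)} \<subseteq> Z"
      using ae unfolding eventually_ae_filter_negligible by blast
    moreover have "?U \<subseteq> {x. \<not> (x \<in> {a..b} \<longrightarrow> f x = g x)}"
      by auto
    ultimately show ?thesis
      by (meson negligible_subset)
  qed
  ultimately have "?U = {}"
    using open_not_negligible by blast
  then have zero: "?h y = 0" if "y \<in> {a<..<b}" for y
    using that by blast
  have closure: "closure {a<..<b} = {a..b}"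
    using \<open>a < b\<close> by (rule closure_greaterThanLessThan)
  have "?h x = 0"
    by (rule continuous_constant_on_closure[of "{a<..<b}"]) (use cont zero closure \<open>x \<in> {a..b}\<close> in simp_all)
  then show ?thesis
    by simp
qed

section \<open>Piecewise polynomials on a closed polygonal chain\<close>

text \<open>Besides the chain, the context fixes the interval \<open>[a, b]\<close> by which every edge is
  parametrized.\<close>

locale closed_chain =
  fixes a b :: real and N :: nat and v :: "nat \<Rightarrow> real^2"
  assumes interval: "a < b" and chain: "simple_closed_polygonal_chain N v"
begin

abbreviation trace :: "nat \<Rightarrow> (real^2 \<Rightarrow> real) \<Rightarrow> real \<Rightarrow> real" where
  "trace \<equiv> edge_trace a b v"

lemma N_ge_3: "3 \<le> N" and v_closed: "v (N + 1) = v 1" and inj_v: "inj_on v {1..N}"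
  using chain by (auto simp: simple_closed_polygonal_chain_def)

lemma v_eq_cases:
  assumes "k \<in> {1..N+1}" "l \<in> {1..N+1}" "v k = v l"
  shows "k = l \<or> k = 1 \<and> l = N + 1 \<or> k = N + 1 \<and> l = 1"
proof -
  have inj: "i = j" if "i \<in> {1..N}" "j \<in> {1..N}" "v i = v j" for i j
    using inj_onD[OF inj_v] that by blast
  have one: "1 \<in> {1..N}"
    using N_ge_3 by auto
  have "k \<in> {1..N} \<or> k = N + 1" "l \<in> {1..N} \<or> l = N + 1"
    using assms by auto
  then consider "k = N + 1" "l = N + 1" | "k = N + 1" "l \<in> {1..N}" | "k \<in> {1..N}" "l = N + 1"
    | "k \<in> {1..N}" "l \<in> {1..N}"
    by blast
  then show ?thesis
  proof cases
    case 2
    then have "v 1 = v l"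
      using assms(3) v_closed by metis
    with 2 inj[OF one] show ?thesis
      by blast
  next
    case 3
    then have "v k = v 1"
      using assms(3) v_closed by metis
    with 3 inj[OF _ one] show ?thesis
      by blast
  qed (use inj assms(3) in blast)+
qed

lemma edge_nontrivial: "i \<in> {1..N} \<Longrightarrow> v i \<noteq> v (i + 1)"
  using v_eq_cases[of i "i + 1"] N_ge_3 by auto

lemma edge_param_conv_linepath: "edge_param a b v i x = linepath (v i) (v (i + 1)) ((x - a) / (b - a))"
proof -
  have "(b - x) / (b - a) = 1 - (x - a) / (b - a)"
    using interval by (simp add: field_simps)
  then show ?thesis
    by (simp add: edge_param_def linepath_def)
qed

lemma linepath_conv_edge_param: "linepath (v i) (v (i + 1)) t = edge_param a b v i (a + (b - a) * t)"
  using interval by (simp add: edge_param_conv_linepath)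

lemma edge_param_endpoints [simp]:
  "edge_param a b v i a = v i" "edge_param a b v i b = v (i + 1)"
  using interval by (simp_all add: edge_param_def)

lemma edge_param_in_edge:
  assumes "x \<in> {a..b}"
  shows "edge_param a b v i x \<in> edge v i"
proof -
  have "(x - a) / (b - a) \<in> {0..1}"
    using assms interval by (auto simp: divide_simps)
  then show ?thesis
    unfolding edge_param_conv_linepath edge_def by (metis imageI linepath_image_01)
qed

lemma edgeE:
  assumes "y \<in> edge v i"
  obtains x where "x \<in> {a..b}" "y = edge_param a b v i x"
proof -
  obtain t where t: "t \<in> {0..1}" "y = linepath (v i) (v (i + 1)) t"
    using assms unfolding edge_def by (metis imageE linepath_image_01)
  have "(b - a) * t \<le> b - a" "0 \<le> (b - a) * t"
    using t interval by (simp_all add: mult_left_le)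
  then have "a + (b - a) * t \<in> {a..b}"
    by auto
  with t(2) show thesis
    using that by (metis linepath_conv_edge_param)
qed

text \<open>The inverse of the parametrization of an edge, extended to the plane by orthogonal projection
  onto the line through that edge.\<close>

definition edge_coord :: "nat \<Rightarrow> real^2 \<Rightarrow> real" where
  "edge_coord i y =
     a + (b - a) * (((y - v i) \<bullet> (v (i + 1) - v i)) / ((v (i + 1) - v i) \<bullet> (v (i + 1) - v i)))"

lemma edge_coord_param:
  assumes "i \<in> {1..N}"
  shows "edge_coord i (edge_param a b v i x) = x"
proof -
  let ?w = "v (i + 1) - v i"
  have "edge_param a b v i x - v i = ((x - a) / (b - a)) *\<^sub>R ?w"
    by (simp add: edge_param_conv_linepath linepath_def algebra_simps)
  moreover have "?w \<bullet> ?w \<noteq> 0"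
    using edge_nontrivial[OF assms] by simp
  ultimately show ?thesis
    using interval by (simp add: edge_coord_def)
qed

lemma edge_param_eq_iff: "i \<in> {1..N} \<Longrightarrow> edge_param a b v i x = edge_param a b v i y \<longleftrightarrow> x = y"
  by (metis edge_coord_param)

lemma edge_param_eq_endpoint_iff:
  assumes "i \<in> {1..N}"
  shows "edge_param a b v i x = v i \<longleftrightarrow> x = a" "edge_param a b v i x = v (i + 1) \<longleftrightarrow> x = b"
  using edge_param_eq_iff[OF assms, of x a] edge_param_eq_iff[OF assms, of x b] by simp_all

lemma edges_meet_at_vertices:
  assumes "i \<in> {1..N}" "j \<in> {1..N}" "i \<noteq> j" "y \<in> edge v i" "y \<in> edge v j"
  shows "y \<in> {v i, v (i + 1)}" "y \<in> {v j, v (j + 1)}"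
  using assms chain unfolding simple_closed_polygonal_chain_def by blast+

text \<open>The function that equals \<open>q i\<close>, in the parameter \<open>x \<in> [a, b]\<close>, on the edge number \<open>i\<close>. At a
  vertex it takes the value prescribed by one of the two adjacent edges.\<close>

definition glue :: "(nat \<Rightarrow> real poly) \<Rightarrow> real^2 \<Rightarrow> real" where
  "glue q y = (let i = SOME i. i \<in> {1..N} \<and> y \<in> edge v i in poly (q i) (edge_coord i y))"

lemma glueE:
  assumes "i \<in> {1..N}" "y \<in> edge v i"
  obtains j where "j \<in> {1..N}" "y \<in> edge v j" "glue q y = poly (q j) (edge_coord j y)"
  using someI[of "\<lambda>i. i \<in> {1..N} \<and> y \<in> edge v i" i] assms
  unfolding glue_def Let_def by blast

lemma glue_interior:
  assumes "i \<in> {1..N}" "x \<in> {a<..<b}"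
  shows "glue q (edge_param a b v i x) = poly (q i) x"
proof -
  let ?y = "edge_param a b v i x"
  have y: "?y \<in> edge v i"
    using assms by (intro edge_param_in_edge) auto
  obtain j where j: "j \<in> {1..N}" "?y \<in> edge v j" "glue q ?y = poly (q j) (edge_coord j ?y)"
    using glueE[OF assms(1) y] by blast
  have "?y \<notin> {v i, v (i + 1)}"
    using assms by (simp add: edge_param_eq_endpoint_iff del: One_nat_def Suc_eq_plus1)
  then have "j = i"
    using edges_meet_at_vertices(1)[OF assms(1) j(1) _ y j(2)] by blast
  with j(3) assms(1) show ?thesis
    by (simp add: edge_coord_param)
qed

text \<open>The values at the vertices are compatible if the end value of each \<open>q i\<close> is the start value of
  \<open>q (i + 1)\<close>, with \<open>q (N + 1)\<close> starting where \<open>q 1\<close> does. Two edges meet only at vertices, so it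
  does not matter which of them the choice in \<open>glue\<close> selects.\<close>

lemma glue_compatible:
  assumes compatible: "\<And>i. i \<in> {1..N} \<Longrightarrow> poly (q i) b = poly (q (i + 1)) a"
    and closed: "poly (q (N + 1)) a = poly (q 1) a"
    and "i \<in> {1..N}" "x \<in> {a..b}"
  shows "glue q (edge_param a b v i x) = poly (q i) x"
proof -
  let ?y = "edge_param a b v i x"
  have y: "?y \<in> edge v i"
    using assms by (intro edge_param_in_edge) auto
  obtain j where j: "j \<in> {1..N}" "?y \<in> edge v j" "glue q ?y = poly (q j) (edge_coord j ?y)"
    using glueE[OF assms(3) y] by blast
  have vertex: "poly (q k) (edge_coord k ?y) = poly (q l) a"
    if k: "k \<in> {1..N}" "?y \<in> {v k, v (k + 1)}" and l: "l \<in> {1..N+1}" "?y = v l" for k l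
  proof -
    have well_defined: "poly (q k') a = poly (q l) a" if "k' \<in> {1..N+1}" "v k' = v l" for k'
      using v_eq_cases[OF that(1) l(1) that(2)] closed by auto
    show ?thesis
    proof (cases "?y = v k")
      case True
      then have "edge_coord k ?y = a"
        using edge_coord_param[OF k(1), of a] by simp
      then show ?thesis
        using well_defined[of k] k True l by simp
    next
      case False
      then have y: "?y = v (k + 1)"
        using k by blast
      then have "edge_coord k ?y = b"
        using edge_coord_param[OF k(1), of b] by simp
      then show ?thesis
        using well_defined[of "k + 1"] k y l compatible[of k] by simp
    qed
  qed
  show ?thesis
  proof (cases "j = i")
    case True
    with j(3) assms(3) show ?thesis
      by (simp add: edge_coord_param)
  next
    case False
    then have meet: "?y \<in> {v i, v (i + 1)}" "?y \<in> {v j, v (j + 1)}"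
      using edges_meet_at_vertices[OF assms(3) j(1) _ y j(2)] by blast+
    then obtain l where "l \<in> {1..N+1}" "?y = v l"
      using assms(3) by (metis atLeastAtMost_iff empty_iff insert_iff le_add2 le_SucI Suc_eq_plus1 Suc_le_mono)
    then have "glue q ?y = poly (q i) (edge_coord i ?y)"
      using vertex[OF j(1) meet(2)] vertex[OF assms(3) meet(1)] j(3) by metis
    with assms(3) show ?thesis
      by (simp add: edge_coord_param)
  qed
qed

text \<open>No compatibility is required: on each edge, \<open>glue q\<close> can deviate from the polynomial only at
  the parameters of the two endpoints.\<close>

lemma glue_in_S_space:
  assumes "\<And>i. i \<in> {1..N} \<Longrightarrow> degree (q i) \<le> m"
  shows "glue q \<in> S_space N v m"
proof -
  let ?f = "\<lambda>i t. glue q (linepath (v i) (v (i + 1)) t)"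
  define r where "r i = pcompose (q i) [:a, b - a:]" for i
  have f_eq: "poly (r i) t = ?f i t"
    if "i \<in> {1..N}" "t \<in> {0..1}" "t \<notin> {0, 1}" for i t
  proof -
    have "(b - a) * t < (b - a) * 1" "0 < (b - a) * t"
      using that interval by (auto intro!: mult_strict_left_mono)
    then show ?thesis
      using that by (simp add: linepath_conv_edge_param glue_interior r_def poly_pcompose mult.commute
        del: One_nat_def Suc_eq_plus1)
  qed
  have null: "emeasure (lebesgue_on {0..1}) {t} = 0" "{t} \<in> sets (lebesgue_on {0..1})"
    if "t \<in> {0, 1}" for t :: real
    using that by (auto simp: emeasure_restrict_space sets_restrict_space_iff)
  have "?f i \<in> borel_measurable (lebesgue_on {0..1})" if "i \<in> {1..N}" for i
  proof (rule measurable_discrete_difference[where f = "poly (r i)" and X = "{0, 1}"])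
    show "poly (r i) \<in> borel_measurable (lebesgue_on {0..1})"
      by (intro continuous_imp_measurable_on_sets_lebesgue continuous_intros) auto
  qed (use null f_eq that in auto)
  moreover have "integrable (lebesgue_on {0..1}) (\<lambda>t. (?f i t)\<^sup>2)" if "i \<in> {1..N}" for i
  proof -
    have "integrable (lebesgue_on {0..1}) (\<lambda>t. (poly (r i) t)\<^sup>2)"
      by (intro continuous_imp_integrable_real continuous_intros)
    then show ?thesis
      by (subst (asm) integrable_discrete_difference[where X = "{0, 1}" and g = "\<lambda>t. (?f i t)\<^sup>2"])
        (use null f_eq that in auto)
  qed
  moreover have "degree (r i) \<le> m" if "i \<in> {1..N}" for i
    using assms[OF that] interval by (simp add: r_def degree_pcompose)
  moreover have "AE t in lebesgue_on {0..1}. ?f i t = poly (r i) t" if "i \<in> {1..N}" for i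
  proof -
    have "AE t in lebesgue. t \<notin> {0, 1 :: real}"
      by (auto simp: eventually_ae_filter_negligible intro!: exI[of _ "{0, 1}"])
    then have "AE t in lebesgue. t \<in> {0..1} \<longrightarrow> ?f i t = poly (r i) t"
      by eventually_elim (use f_eq that in auto)
    then show ?thesis
      by (subst AE_restrict_space_iff) auto
  qed
  ultimately show ?thesis
    unfolding S_space_def L2_bdry_def by blast
qed

lemma glue_in_S0_space:
  assumes compatible: "\<And>i. i \<in> {1..N} \<Longrightarrow> poly (q i) b = poly (q (i + 1)) a"
    and closed: "poly (q (N + 1)) a = poly (q 1) a"
    and degree: "\<And>i. i \<in> {1..N} \<Longrightarrow> degree (q i) \<le> m"
    and frontier: "frontier K = (\<Union>i\<in>{1..N}. edge v i)"
  shows "glue q \<in> S0_space K N v m"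
proof -
  have "continuous_on (edge v i) (glue q)" if i: "i \<in> {1..N}" for i
  proof -
    have "glue q y = poly (q i) (edge_coord i y)" if y: "y \<in> edge v i" for y
    proof -
      obtain x where "x \<in> {a..b}" "y = edge_param a b v i x"
        using y by (rule edgeE)
      with glue_compatible[OF compatible closed i] edge_coord_param[OF i] show ?thesis
        by metis
    qed
    moreover have "continuous_on (edge v i) (\<lambda>y. poly (q i) (edge_coord i y))"
      using edge_nontrivial[OF i] unfolding edge_coord_def by (intro continuous_intros) auto
    ultimately show ?thesis
      by (simp cong: continuous_on_cong)
  qed
  then have "continuous_on (frontier K) (glue q)"
    unfolding frontier by (intro continuous_on_closed_Union) (auto simp: edge_def)
  then show ?thesis
    using glue_in_S_space[OF degree] by (simp add: S0_space_def)
qed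

lemma ae_eq_bdry_imp_trace_eq:
  assumes "ae_eq_bdry N v f g" "i \<in> {1..N}"
  shows "AE x in lebesgue. x \<in> {a..b} \<longrightarrow> trace i f x = trace i g x"
  using assms unfolding ae_eq_bdry_def edge_trace_def edge_param_conv_linepath
  by (intro AE_affine_unit_interval interval) auto

lemma S_space_trace_poly:
  assumes "f \<in> S_space N v m" "i \<in> {1..N}"
  shows "\<exists>q. degree q \<le> m \<and> (AE x in lebesgue. x \<in> {a..b} \<longrightarrow> trace i f x = poly q x)"
proof -
  obtain p where p: "degree p \<le> m"
      "AE t in lebesgue_on {0..1}. f (linepath (v i) (v (i + 1)) t) = poly p t"
    using assms unfolding S_space_def by blast
  let ?q = "pcompose p [:- a / (b - a), 1 / (b - a):]"
  have "poly ?q x = poly p ((x - a) / (b - a))" for x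
    by (simp add: poly_pcompose diff_divide_distrib)
  then have "AE x in lebesgue. x \<in> {a..b} \<longrightarrow> trace i f x = poly ?q x"
    using AE_affine_unit_interval[OF interval p(2)]
    by (simp add: edge_trace_def edge_param_conv_linepath)
  moreover have "degree ?q \<le> m"
    using p(1) interval by (simp add: degree_pcompose)
  ultimately show ?thesis
    by blast
qed

lemma S0_space_trace_poly:
  assumes "f \<in> S0_space K N v m" "i \<in> {1..N}" and frontier: "frontier K = (\<Union>i\<in>{1..N}. edge v i)"
  shows "\<exists>q. degree q \<le> m \<and> (\<forall>x\<in>{a..b}. trace i f x = poly q x)"
proof -
  have f: "f \<in> S_space N v m" "continuous_on (frontier K) f"
    using assms(1) by (auto simp: S0_space_def)
  obtain q where q: "degree q \<le> m" "AE x in lebesgue. x \<in> {a..b} \<longrightarrow> trace i f x = poly q x"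
    using S_space_trace_poly[OF f(1) assms(2)] by blast
  have "continuous_on {a..b} (trace i f)"
    unfolding edge_trace_def
  proof (rule continuous_on_compose2[OF f(2)])
    show "continuous_on {a..b} (edge_param a b v i)"
      unfolding edge_param_def by (intro continuous_intros) (use interval in auto)
    show "edge_param a b v i ` {a..b} \<subseteq> frontier K"
      using assms(2) edge_param_in_edge unfolding frontier by blast
  qed
  then have "trace i f x = poly q x" if "x \<in> {a..b}" for x
    using that q(2) interval by (intro continuous_AE_eq_imp_eq[where f = "trace i f"] continuous_intros)
  with q(1) show ?thesis
    by blast
qed

end

section \<open>Unisolvence\<close>

text \<open>The data of the boundary element. Of the region \<open>K\<close>, only its boundary enters.\<close>

locale boundary_element =
  weighted_orthogonal a b \<omega> P + closed_chain a b N v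
  for a b :: real and \<omega> :: "real \<Rightarrow> real" and P :: "nat \<Rightarrow> real poly"
    and N :: nat and v :: "nat \<Rightarrow> real^2" +
  fixes K :: "(real^2) set" and m :: nat and B :: "nat \<Rightarrow> real^2 \<Rightarrow> real"
  assumes frontier_K: "frontier K = (\<Union>i\<in>{1..N}. edge v i)"
    and m_pos: "1 \<le> m"
    and basis: "basis_of_S N v (m - 1) (m * N) B"
begin

lemma dof_eq_sum_wint:
  assumes f: "\<And>i. i \<in> {1..N} \<Longrightarrow> AE x in lebesgue. x \<in> {a..b} \<longrightarrow> trace i f x = poly (p i) x"
    and Bj: "\<And>i. i \<in> {1..N} \<Longrightarrow> AE x in lebesgue. x \<in> {a..b} \<longrightarrow> trace i (B j) x = poly (r i) x"
  shows "dof a b \<omega> N v B j f = (\<Sum>i=1..N. wint (p i * r i))"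
  unfolding dof_def
proof (rule sum.cong[OF refl])
  fix i
  assume i: "i \<in> {1..N}"
  have "AE x in lebesgue. x \<in> {a..b} \<longrightarrow>
      trace i f x * trace i (B j) x * \<omega> x = poly (p i * r i) x * \<omega> x"
    using f[OF i] Bj[OF i] by eventually_elim simp
  then show "(LINT x:{a..b}|lebesgue. trace i f x * trace i (B j) x * \<omega> x) = wint (p i * r i)"
    unfolding wint_def by (rule set_lebesgue_integral_spike)
qed

text \<open>The polynomial that represents the basis function \<open>B j\<close> on the edge number \<open>i\<close>.\<close>

definition R :: "nat \<Rightarrow> nat \<Rightarrow> real poly" where
  "R j i = (SOME r. degree r \<le> m - 1 \<and>
     (AE x in lebesgue. x \<in> {a..b} \<longrightarrow> trace i (B j) x = poly r x))"

lemma
  assumes "i \<in> {1..N}" "j \<in> {1..m * N}"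
  shows degree_R: "degree (R j i) < m"
    and trace_R: "AE x in lebesgue. x \<in> {a..b} \<longrightarrow> trace i (B j) x = poly (R j i) x"
proof -
  have Bj: "B j \<in> S_space N v (m - 1)"
    using basis assms(2) by (auto simp: basis_of_S_def)
  have *: "degree (R j i) \<le> m - 1 \<and>
      (AE x in lebesgue. x \<in> {a..b} \<longrightarrow> trace i (B j) x = poly (R j i) x)"
    unfolding R_def by (rule someI_ex[OF S_space_trace_poly[OF Bj assms(1)]])
  show "degree (R j i) < m"
    using *[THEN conjunct1] m_pos by linarith
  show "AE x in lebesgue. x \<in> {a..b} \<longrightarrow> trace i (B j) x = poly (R j i) x"
    using *[THEN conjunct2] .
qed

text \<open>Discontinuous functions supported on a single edge belong to \<open>S\<^sub>m\<^sub>-\<^sub>1\<close>, so the degrees of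
  freedom test each edge separately.\<close>

lemma dofs_vanish_imp_multiple_of_P:
  assumes p: "\<And>i x. i \<in> {1..N} \<Longrightarrow> x \<in> {a..b} \<Longrightarrow> trace i f x = poly (p i) x"
    and deg: "\<And>i. i \<in> {1..N} \<Longrightarrow> degree (p i) \<le> m"
    and dofs: "\<And>j. j \<in> {1..m * N} \<Longrightarrow> dof a b \<omega> N v B j f = 0"
    and k: "k \<in> {1..N}"
  shows "\<exists>c. p k = smult c (P m)"
proof (rule orthogonal_imp_multiple_of_P[OF deg[OF k] m_pos])
  fix q :: "real poly"
  assume q: "degree q < m"
  \<comment> \<open>The test function equals \<open>q\<close> on the edge \<open>k\<close> and vanishes on the others.\<close>
  define s where "s i = (if i = k then q else 0)" for i
  have "degree (s i) \<le> m - 1" for i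
    using q by (auto simp: s_def)
  then have "glue s \<in> S_space N v (m - 1)"
    by (rule glue_in_S_space)
  then obtain c where c: "ae_eq_bdry N v (glue s) (\<lambda>y. \<Sum>j=1..m * N. c j * B j y)"
    using basis unfolding basis_of_S_def by blast
  have expand: "wint (p i * s i) = (\<Sum>j=1..m * N. c j * wint (p i * R j i))" if i: "i \<in> {1..N}" for i
  proof -
    have "AE x in lebesgue. \<forall>j\<in>{1..m * N}. x \<in> {a..b} \<longrightarrow> trace i (B j) x = poly (R j i) x"
      using trace_R[OF i] by (intro AE_finite_allI) auto
    moreover have "AE x in lebesgue. x \<in> {a..b} \<longrightarrow>
        trace i (glue s) x = trace i (\<lambda>y. \<Sum>j=1..m * N. c j * B j y) x"
      using c i by (rule ae_eq_bdry_imp_trace_eq)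
    \<comment> \<open>The values of \<open>glue s\<close> at the vertices are not known, as \<open>s\<close> jumps there.\<close>
    moreover have "AE x in lebesgue. x \<notin> {a, b}"
      unfolding eventually_ae_filter_negligible by (intro exI[of _ "{a, b}"]) auto
    ultimately have "AE x in lebesgue. x \<in> {a..b} \<longrightarrow>
        poly (p i * s i) x * \<omega> x = poly (\<Sum>j=1..m * N. smult (c j) (p i * R j i)) x * \<omega> x"
    proof eventually_elim
      case (elim x)
      show ?case
      proof
        assume x: "x \<in> {a..b}"
        then have "poly (s i) x = trace i (glue s) x"
          using elim(3) glue_interior[OF i, of x s] by (simp add: edge_trace_def)
        also have "\<dots> = (\<Sum>j=1..m * N. c j * trace i (B j) x)"
          using elim(2) x by (simp add: edge_trace_def)
        also have "\<dots> = (\<Sum>j=1..m * N. c j * poly (R j i) x)"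
          using elim(1) x by (intro sum.cong) auto
        finally show "poly (p i * s i) x * \<omega> x = poly (\<Sum>j=1..m * N. smult (c j) (p i * R j i)) x * \<omega> x"
          by (simp add: poly_sum sum_distrib_left mult_ac)
      qed
    qed
    then have "wint (p i * s i) = wint (\<Sum>j=1..m * N. smult (c j) (p i * R j i))"
      unfolding wint_def by (rule set_lebesgue_integral_spike)
    then show ?thesis
      by (simp add: wint_sum wint_smult)
  qed
  have "(\<Sum>i=1..N. wint (p i * s i)) = (\<Sum>i=1..N. \<Sum>j=1..m * N. c j * wint (p i * R j i))"
    using expand by (intro sum.cong) auto
  also have "\<dots> = (\<Sum>j=1..m * N. c j * (\<Sum>i=1..N. wint (p i * R j i)))"
    by (subst sum.swap) (simp add: sum_distrib_left)
  also have "\<dots> = (\<Sum>j=1..m * N. c j * dof a b \<omega> N v B j f)"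
  proof (rule sum.cong[OF refl])
    fix j
    assume "j \<in> {1..m * N}"
    then have "dof a b \<omega> N v B j f = (\<Sum>i=1..N. wint (p i * R j i))"
      using p trace_R by (intro dof_eq_sum_wint) auto
    then show "c j * (\<Sum>i=1..N. wint (p i * R j i)) = c j * dof a b \<omega> N v B j f"
      by simp
  qed
  also have "\<dots> = 0"
    using dofs by (intro sum.neutral) auto
  finally have "(\<Sum>i=1..N. wint (p i * s i)) = 0" .
  moreover have "(\<Sum>i=1..N. wint (p i * s i)) = (\<Sum>i=1..N. if i = k then wint (p k * q) else 0)"
    by (intro sum.cong) (auto simp: s_def)
  ultimately show "wint (p k * q) = 0"
    using k by simp
qed

text \<open>The factor by which the coefficient of \<open>P m\<close> must change from one edge to the next in order
  to achieve continuity at the common vertex.\<close>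

definition ratio :: real where
  "ratio = poly (P m) b / poly (P m) a"

lemma P_b_eq: "poly (P m) b = ratio * poly (P m) a"
  using P_endpoint_nonzero[OF m_pos, of a] by (simp add: ratio_def)

text \<open>On the edge \<open>i\<close> the function is \<open>c i\<close> times \<open>P m\<close>, where \<open>c (i + 1) = c i * ratio\<close>; going once
  around the chain gives \<open>c 1 = c 1 * ratio ^ N\<close>.\<close>

lemma unisolvent_if_ratio:
  assumes ratio: "ratio ^ N \<noteq> 1"
    and f: "f \<in> S0_space K N v m"
    and dofs: "\<And>j. j \<in> {1..m * N} \<Longrightarrow> dof a b \<omega> N v B j f = 0"
    and y: "y \<in> frontier K"
  shows "f y = 0"
proof -
  have "\<exists>p. i \<in> {1..N} \<longrightarrow> degree p \<le> m \<and> (\<forall>x\<in>{a..b}. trace i f x = poly p x)" for i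
    using S0_space_trace_poly[OF f _ frontier_K, of i] by blast
  then obtain p where p: "i \<in> {1..N} \<longrightarrow> degree (p i) \<le> m \<and> (\<forall>x\<in>{a..b}. trace i f x = poly (p i) x)"
    for i
    by metis
  have "\<exists>c. i \<in> {1..N} \<longrightarrow> p i = smult c (P m)" for i
    using dofs_vanish_imp_multiple_of_P[of f p i] p dofs by blast
  then obtain c where c: "i \<in> {1..N} \<longrightarrow> p i = smult (c i) (P m)" for i
    by metis
  have trace: "trace i f x = c i * poly (P m) x" if "i \<in> {1..N}" "x \<in> {a..b}" for i x
    using p[of i] c[of i] that by simp
  have left: "f (v i) = c i * poly (P m) a"
    and right: "f (v (i + 1)) = c i * ratio * poly (P m) a" if "i \<in> {1..N}" for i
    using trace[OF that, of a] trace[OF that, of b] interval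
    by (simp_all add: edge_trace_def P_b_eq)
  have Pa: "poly (P m) a \<noteq> 0"
    using P_endpoint_nonzero m_pos by blast
  have step: "c (i + 1) = c i * ratio" if "1 \<le> i" "i < N" for i
  proof -
    have "c (i + 1) * poly (P m) a = c i * ratio * poly (P m) a"
      using left[of "i + 1"] right[of i] that by simp
    with Pa show ?thesis
      by simp
  qed
  have power: "c (Suc i) = c 1 * ratio ^ i" if "i < N" for i
    using that
  proof (induction i)
    case (Suc i)
    then have "c (Suc (Suc i)) = c (Suc i) * ratio"
      using step[of "Suc i"] by simp
    also have "\<dots> = c 1 * ratio ^ Suc i"
      using Suc by simp
    finally show ?case .
  qed simp
  have "c 1 * poly (P m) a = c N * ratio * poly (P m) a"
    using left[of 1] right[of N] v_closed N_ge_3 by auto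
  then have "c 1 = c N * ratio"
    using Pa by simp
  also have "\<dots> = c 1 * ratio ^ N"
    using power[of "N - 1"] N_ge_3 by (simp add: power_eq_if)
  finally have "c 1 = 0"
    using ratio by simp
  then have c_0: "c i = 0" if "i \<in> {1..N}" for i
    using power[of "i - 1"] that by (cases i) auto
  obtain i where i: "i \<in> {1..N}" "y \<in> edge v i"
    using y frontier_K by blast
  obtain x where "x \<in> {a..b}" "y = edge_param a b v i x"
    using i(2) by (rule edgeE)
  then show "f y = 0"
    using trace[OF i(1), of x] c_0[OF i(1)] by (simp add: edge_trace_def)
qed

text \<open>Now the geometric sequence of coefficients closes up after \<open>N\<close> steps and yields a nonzero
  continuous function.\<close>

lemma not_unisolvent_if_ratio:
  assumes ratio: "ratio ^ N = 1"
  obtains f y where "f \<in> S0_space K N v m" "\<And>j. j \<in> {1..m * N} \<Longrightarrow> dof a b \<omega> N v B j f = 0"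
    "y \<in> frontier K" "f y \<noteq> 0"
proof -
  define q where "q i = smult (ratio ^ (i - 1)) (P m)" for i
  have compatible: "poly (q i) b = poly (q (i + 1)) a" if "i \<in> {1..N}" for i
  proof -
    have "ratio ^ i = ratio ^ (i - 1) * ratio"
      using that by (simp add: power_eq_if)
    then show ?thesis
      unfolding q_def poly_smult P_b_eq by simp
  qed
  have closed: "poly (q (N + 1)) a = poly (q 1) a"
    using ratio by (simp add: q_def)
  have glue: "trace i (glue q) x = poly (q i) x" if "i \<in> {1..N}" "x \<in> {a..b}" for i x
    unfolding edge_trace_def using compatible closed that by (rule glue_compatible)
  have one: "1 \<in> {1..N}"
    using N_ge_3 by auto
  show thesis
  proof (rule that)
    show "glue q \<in> S0_space K N v m"
      using compatible closed frontier_K degree_P[of m]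
      by (intro glue_in_S0_space) (auto simp: q_def intro: order_trans[OF degree_smult_le])
    show "dof a b \<omega> N v B j (glue q) = 0" if j: "j \<in> {1..m * N}" for j
    proof -
      have "dof a b \<omega> N v B j (glue q) = (\<Sum>i=1..N. wint (q i * R j i))"
        using glue trace_R j by (intro dof_eq_sum_wint) auto
      also have "\<dots> = 0"
        using degree_R j by (intro sum.neutral) (simp add: q_def wint_smult wint_P_less)
      finally show ?thesis .
    qed
    have "v 1 = edge_param a b v 1 a"
      by (rule edge_param_endpoints(1)[symmetric])
    then show "v 1 \<in> frontier K"
      unfolding frontier_K using edge_param_in_edge[of a 1] interval one by fastforce
    have "glue q (v 1) = poly (P m) a"
      using glue[OF one, of a] interval by (simp add: edge_trace_def q_def)
    then show "glue q (v 1) \<noteq> 0"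
      using P_endpoint_nonzero m_pos by simp
  qed
qed

end

theorem theorem1:
  fixes a b :: real and \<omega> :: "real \<Rightarrow> real" and P :: "nat \<Rightarrow> real poly"
    and K :: "(real^2) set" and N m :: nat and v :: "nat \<Rightarrow> real^2"
    and B :: "nat \<Rightarrow> real^2 \<Rightarrow> real"
  assumes "a < b"
    and "weight_function a b \<omega>"
    and "orthogonal_polynomials a b \<omega> P"
    and "polygon_ccw K N v"
    and "1 \<le> m"
    and "basis_of_S N v (m - 1) (m * N) B"
  shows "(poly (P m) b / poly (P m) a) ^ N \<noteq> 1
     \<longleftrightarrow> defines_finite_element (bdry_triple a b \<omega> K N v m B)"
proof -
  interpret boundary_element a b \<omega> P N v K m B
    using assms by unfold_locales (auto simp: polygon_ccw_def)
  have "defines_finite_element (bdry_triple a b \<omega> K N v m B) \<longleftrightarrow>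
      (\<forall>f\<in>S0_space K N v m. (\<forall>j\<in>{1..m * N}. dof a b \<omega> N v B j f = 0) \<longrightarrow>
        (\<forall>y\<in>frontier K. f y = 0))"
    by (simp add: defines_finite_element_def bdry_triple_def)
  then show ?thesis
    unfolding ratio_def[symmetric] using unisolvent_if_ratio not_unisolvent_if_ratio by metis
qed

end
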